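(* Fix $\hat{\bm y}\in\mathbb R^d$ and let $\mathcal Z\subseteq\mathbb R^d$ be nonempty, compact, and convex. For $\vartheta\ge 0$ let $\mathcal S_{\rm ball}(\vartheta):=\operatorname{argmin}_{\bm z\in\mathcal Z}\{\hat{\bm y}^\top\bm z+\vartheta\|\bm z\|_2\}$. For $\gamma>0$ let $\bm z^\star_\gamma(\hat{\bm y})$ be the unique minimizer of $\hat{\bm y}^\top\bm z+\frac\gamma2\|\bm z\|_2^2$ over $\bm z\in\mathcal Z$. Define $\mathcal Z_0(\hat{\bm y})=\operatorname{argmin}_{\bm z\in\mathcal Z}\hat{\bm y}^\top\bm z$ and $\bm z^\star_\infty(\hat{\bm y}):=\Pi_{\mathcal Z}(\bm 0)=\lim_{\gamma\to\infty}\bm z^\star_\gamma(\hat{\bm y})$, where $\Pi_{\mathcal Z}$ is the Euclidean projection onto $\mathcal Z$. Then the following hold. (i) For every $\vartheta\ge0$ and every $\bar{\bm z}\in\mathcal S_{\rm ball}(\vartheta)$: if $\bar{\bm z}\ne\bm 0$ and $\vartheta>0$, then $\bar{\bm z}=\bm z^\star_\gamma(\hat{\bm y})$ with $\gamma=\vartheta/\|\bar{\bm z}\|_2$; if $\vartheta=0$, then $\bar{\bm z}\in\mathcal Z_0(\hat{\bm y})$; if $\bar{\bm z}=\bm 0$, then $\bar{\bm z}=\bm z^\star_\infty(\hat{\bm y})$. (ii) For every $\gamma>0$, $\bm z^\star_\gamma(\hat{\bm y})\in\mathcal S_{\rm ball}(\vartheta(\gamma))$ with $\vartheta(\gamma):=\gamma\|\bm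 z^\star_\gamma(\hat{\bm y})\|_2$. (iii) The map $\gamma\mapsto\vartheta(\gamma)$ is nondecreasing on $(0,\infty)$.
   Context: All notation is defined in the claim. *)

theory Defs
  imports "HOL-Analysis.Analysis"
begin

definition argmin_set :: "('a \<Rightarrow> real) \<Rightarrow> 'a set \<Rightarrow> 'a set" where
  "argmin_set f Z = {z. is_arg_min f (\<lambda>z. z \<in> Z) z}"

definition S_ball :: "real ^ 'd \<Rightarrow> (real ^ 'd) set \<Rightarrow> real \<Rightarrow> (real ^ 'd) set" where
  "S_ball y Z \<theta> = argmin_set (\<lambda>z. y \<bullet> z + \<theta> * norm z) Z"

definition reg_objective :: "real ^ 'd \<Rightarrow> real \<Rightarrow> real ^ 'd \<Rightarrow> real" where
  "reg_objective y \<gamma> z = y \<bullet> z + \<gamma> / 2 * (norm z)\<^sup>2"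

(* THE is meaningful only when the minimizer exists and is unique, as for \<gamma> > 0 and
   Z nonempty, compact and convex. *)
definition z_star :: "real ^ 'd \<Rightarrow> (real ^ 'd) set \<Rightarrow> real \<Rightarrow> real ^ 'd" where
  "z_star y Z \<gamma> = (THE z. z \<in> argmin_set (reg_objective y \<gamma>) Z)"

definition Z_zero :: "real ^ 'd \<Rightarrow> (real ^ 'd) set \<Rightarrow> (real ^ 'd) set" where
  "Z_zero y Z = argmin_set (\<lambda>z. y \<bullet> z) Z"

(* This is the limit of z_star y Z \<gamma> as \<gamma> tends to infinity, whatever y is. *)
definition z_star_inf :: "(real ^ 'd) set \<Rightarrow> real ^ 'd" where
  "z_star_inf Z = closest_point Z 0"

definition theta_of :: "real ^ 'd \<Rightarrow> (real ^ 'd) set \<Rightarrow> real \<Rightarrow> real" where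
  "theta_of y Z \<gamma> = \<gamma> * norm (z_star y Z \<gamma>)"

end

(* Completing the square, the regularized minimizer is the Euclidean projection of - y / \<gamma> onto Z;
   hence existence, uniqueness, the variational inequality, and (by continuity of the projection)
   the limit. Passing from the ball problem to the regularized one is AM-GM
   \<theta> |z| \<le> \<gamma>/2 |z|^2 + \<theta> |zb| / 2, with equality at zb. The converse combines the
   variational inequality with Cauchy-Schwarz, and adding the variational inequalities for two
   parameters gives (|z1| - |z2|) (\<theta>2 - \<theta>1) \<ge> 0, whence monotonicity. *)
theory Submission
  imports Defs
begin

lemma mem_argmin_set_iff: "z \<in> argmin_set f Z \<longleftrightarrow> z \<in> Z \<and> (\<forall>w\<in>Z. f z \<le> f w)"
  for f :: "'a \<Rightarrow> real"
  by (auto simp: argmin_set_def is_arg_min_linorder)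

lemma reg_objective_complete_square:
  assumes "\<gamma> > 0"
  shows "reg_objective y \<gamma> z = \<gamma> / 2 * (dist (- (y /\<^sub>R \<gamma>)) z)\<^sup>2 - (norm y)\<^sup>2 / (2 * \<gamma>)"
proof -
  have "(dist (- (y /\<^sub>R \<gamma>)) z)\<^sup>2 = (norm (z + y /\<^sub>R \<gamma>))\<^sup>2"
    by (simp add: dist_norm norm_minus_commute)
  also have "\<dots> = (norm z)\<^sup>2 + 2 * (y \<bullet> z) / \<gamma> + (norm y)\<^sup>2 / \<gamma>\<^sup>2"
    unfolding power2_norm_eq_inner
    by (simp add: inner_add_left inner_add_right inner_commute power2_eq_square field_simps)
  finally show ?thesis
    using assms by (simp add: reg_objective_def power2_eq_square field_simps)
qed

lemma reg_argmin_iff_closest_point: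
  fixes Z :: "(real ^ 'd) set"
  assumes Z: "Z \<noteq> {}" "closed Z" "convex Z" and \<gamma>: "\<gamma> > 0"
  shows "z \<in> argmin_set (reg_objective y \<gamma>) Z \<longleftrightarrow> z = closest_point Z (- (y /\<^sub>R \<gamma>))"
proof -
  \<comment> \<open>The term \<open>(norm y)\<^sup>2 / (2 * \<gamma>)\<close> does not depend on the
    point and cancels; the factor \<open>\<gamma> / 2\<close> is positive, and squaring preserves
    the order of distances.\<close>
  have le: "reg_objective y \<gamma> u \<le> reg_objective y \<gamma> v
      \<longleftrightarrow> dist (- (y /\<^sub>R \<gamma>)) u \<le> dist (- (y /\<^sub>R \<gamma>)) v" for u v
    using \<gamma> by (simp add: reg_objective_complete_square abs_le_square_iff[symmetric])
  show ?thesis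
    unfolding mem_argmin_set_iff le
    using closest_point_in_set[of Z] closest_point_le[of Z] closest_point_unique[of Z] Z by metis
qed

lemma z_star_eq_closest_point:
  fixes Z :: "(real ^ 'd) set"
  assumes "Z \<noteq> {}" "closed Z" "convex Z" "\<gamma> > 0"
  shows "z_star y Z \<gamma> = closest_point Z (- (y /\<^sub>R \<gamma>))"
  unfolding z_star_def using assms by (simp add: reg_argmin_iff_closest_point)

lemma z_star_in:
  fixes Z :: "(real ^ 'd) set"
  assumes "Z \<noteq> {}" "closed Z" "convex Z" "\<gamma> > 0"
  shows "z_star y Z \<gamma> \<in> Z"
  using assms by (simp add: z_star_eq_closest_point closest_point_in_set)

text \<open>First-order optimality: \<open>y + \<gamma> *\<^sub>R z\<close> is the gradient of the
  regularized objective at \<open>z\<close>. It comes from the obtuse-angle property of the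
  projection, scaled by \<open>- \<gamma>\<close>.\<close>

lemma z_star_variational_inequality:
  fixes Z :: "(real ^ 'd) set"
  assumes Z: "Z \<noteq> {}" "closed Z" "convex Z" and \<gamma>: "\<gamma> > 0" and w: "w \<in> Z"
  shows "(y + \<gamma> *\<^sub>R z_star y Z \<gamma>) \<bullet> (w - z_star y Z \<gamma>) \<ge> 0"
proof -
  let ?z = "z_star y Z \<gamma>"
  have "(- (y /\<^sub>R \<gamma>) - ?z) \<bullet> (w - ?z) \<le> 0"
    using closest_point_dot[OF Z(3,2) w, of "- (y /\<^sub>R \<gamma>)"] z_star_eq_closest_point[OF Z \<gamma>]
    by simp
  moreover have "y + \<gamma> *\<^sub>R ?z = - \<gamma> *\<^sub>R (- (y /\<^sub>R \<gamma>) - ?z)"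
    using \<gamma> by (simp add: scaleR_right_diff_distrib)
  ultimately show ?thesis
    using \<gamma> by (simp add: mult_le_0_iff)
qed

lemma z_star_tendsto_z_star_inf:
  fixes Z :: "(real ^ 'd) set"
  assumes Z: "Z \<noteq> {}" "closed Z" "convex Z"
  shows "(z_star y Z \<longlongrightarrow> z_star_inf Z) at_top"
proof -
  have "((\<lambda>\<gamma>. - (y /\<^sub>R \<gamma>)) \<longlongrightarrow> - (0 *\<^sub>R y)) at_top"
    by (intro tendsto_intros tendsto_inverse_0_at_top filterlim_ident)
  then have "((\<lambda>\<gamma>. closest_point Z (- (y /\<^sub>R \<gamma>))) \<longlongrightarrow> closest_point Z 0) at_top"
    using isCont_tendsto_compose[OF continuous_at_closest_point[OF Z(3,2,1)]] by simp
  \<comment> \<open>The projection formula is available for positive \<gamma>, hence eventually at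
    infinity.\<close>
  moreover have "\<forall>\<^sub>F \<gamma> in at_top. closest_point Z (- (y /\<^sub>R \<gamma>)) = z_star y Z \<gamma>"
    using eventually_gt_at_top[of 0]
    by eventually_elim (simp add: z_star_eq_closest_point[OF Z])
  ultimately show ?thesis
    unfolding z_star_inf_def by (rule Lim_transform_eventually)
qed

lemma S_ball_subset_reg_argmin:
  assumes zb: "zb \<in> S_ball y Z \<theta>" "zb \<noteq> 0" and \<theta>: "\<theta> > 0"
  shows "zb \<in> argmin_set (reg_objective y (\<theta> / norm zb)) Z"
proof -
  have "reg_objective y (\<theta> / norm zb) zb \<le> reg_objective y (\<theta> / norm zb) w" if "w \<in> Z" for w
  proof -
    \<comment> \<open>The weight \<open>\<theta> / norm zb\<close> makes the quadratic penalty, up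
      to a constant, touch the linear one from above exactly at radius
      \<open>norm zb\<close>.\<close>
    have "0 \<le> \<theta> / (2 * norm zb) * (norm w - norm zb)\<^sup>2"
      using \<theta> by simp
    also have "\<dots> = \<theta> / norm zb / 2 * (norm w)\<^sup>2 - \<theta> * norm w + \<theta> * norm zb / 2"
      using zb(2) by (simp add: power2_eq_square field_simps)
    finally have "\<theta> * norm w \<le> \<theta> / norm zb / 2 * (norm w)\<^sup>2 + \<theta> * norm zb / 2"
      by simp
    moreover have "y \<bullet> zb + \<theta> * norm zb \<le> y \<bullet> w + \<theta> * norm w"
      using zb(1) that by (simp add: S_ball_def mem_argmin_set_iff)
    \<comment> \<open>The equality case at \<open>zb\<close>: the constant lost in the bound for
      \<open>w\<close> is recovered here.\<close>
    moreover have "\<theta> / norm zb / 2 * (norm zb)\<^sup>2 = \<theta> * norm zb / 2"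
      by (simp add: power2_eq_square)
    ultimately show ?thesis
      unfolding reg_objective_def by argo
  qed
  then show ?thesis
    using zb(1) by (simp add: S_ball_def mem_argmin_set_iff)
qed

text \<open>For \<open>z \<noteq> 0\<close>, the choice \<open>\<theta> = \<gamma> * norm z\<close>
  makes the gradients of both penalties agree at \<open>z\<close>. The argument by Cauchy-Schwarz
  never divides by \<open>norm z\<close>, so it covers \<open>z = 0\<close> as well.\<close>

lemma z_star_in_S_ball:
  fixes Z :: "(real ^ 'd) set"
  assumes Z: "Z \<noteq> {}" "closed Z" "convex Z" and \<gamma>: "\<gamma> > 0"
  shows "z_star y Z \<gamma> \<in> S_ball y Z (theta_of y Z \<gamma>)"
proof -
  let ?z = "z_star y Z \<gamma>"
  have "y \<bullet> ?z + \<gamma> * norm ?z * norm ?z \<le> y \<bullet> w + \<gamma> * norm ?z * norm w" if "w \<in> Z" for w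
  proof -
    have "\<gamma> * (?z \<bullet> w) \<le> \<gamma> * (norm ?z * norm w)"
      using \<gamma> norm_cauchy_schwarz by simp
    moreover have "0 \<le> y \<bullet> w - y \<bullet> ?z + \<gamma> * (?z \<bullet> w) - \<gamma> * (norm ?z * norm ?z)"
      using z_star_variational_inequality[OF Z \<gamma> that, of y]
      by (simp add: inner_simps algebra_simps flip: power2_norm_eq_inner power2_eq_square)
    ultimately show ?thesis
      by (simp add: mult.assoc)
  qed
  then show ?thesis
    using z_star_in[OF Z \<gamma>] by (simp add: S_ball_def mem_argmin_set_iff theta_of_def)
qed

lemma theta_of_mono:
  fixes Z :: "(real ^ 'd) set"
  assumes Z: "Z \<noteq> {}" "closed Z" "convex Z"
  shows "mono_on {0<..} (theta_of y Z)"
proof (rule mono_onI)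
  fix g h :: real
  assume gh: "g \<in> {0<..}" "h \<in> {0<..}" "g \<le> h"
  then have pos: "g > 0" "h > 0"
    by auto
  let ?u = "z_star y Z g" and ?v = "z_star y Z h"
  \<comment> \<open>Each minimizer is the test point in the inequality of the other; in the sum the
    terms with \<open>y\<close> cancel.\<close>
  have "0 \<le> (y + g *\<^sub>R ?u) \<bullet> (?v - ?u) + (y + h *\<^sub>R ?v) \<bullet> (?u - ?v)"
    using z_star_variational_inequality[OF Z] z_star_in[OF Z] pos by (simp add: add_nonneg_nonneg)
  also have "\<dots> = (g + h) * (?u \<bullet> ?v) - g * (norm ?u * norm ?u) - h * (norm ?v * norm ?v)"
    by (simp add: inner_simps inner_commute algebra_simps
        flip: power2_norm_eq_inner power2_eq_square)
  also have "\<dots> \<le> (g + h) * (norm ?u * norm ?v) - g * (norm ?u * norm ?u) - h * (norm ?v * norm ?v)"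
    using pos norm_cauchy_schwarz[of ?u ?v] by simp
  also have "\<dots> = (norm ?u - norm ?v) * (h * norm ?v - g * norm ?u)"
    by (simp add: algebra_simps)
  finally have prod: "0 \<le> (norm ?u - norm ?v) * (h * norm ?v - g * norm ?u)" .
  show "theta_of y Z g \<le> theta_of y Z h"
  \<comment> \<open>If the norm does not drop, both factors of \<theta> grow weakly; if it drops,
    the first factor in \<open>prod\<close> is positive, so the second, the difference of the two
    \<theta> values, is nonnegative.\<close>
  proof (cases "norm ?u \<le> norm ?v")
    case True
    then show ?thesis
      unfolding theta_of_def using gh pos by (intro mult_mono) auto
  next
    case False
    then show ?thesis
      unfolding theta_of_def using prod by (simp add: zero_le_mult_iff)
  qed
qed

theorem mainTheorem10:
  fixes y :: "real ^ 'd" and Z :: "(real ^ 'd) set"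
  assumes "Z \<noteq> {}" and "compact Z" and "convex Z"
  shows "(\<forall>\<gamma>>0. \<exists>!z. z \<in> argmin_set (reg_objective y \<gamma>) Z)
    \<and> (z_star y Z \<longlongrightarrow> z_star_inf Z) at_top
    \<and> (\<forall>\<theta>\<ge>0. \<forall>zb \<in> S_ball y Z \<theta>.
          (zb \<noteq> 0 \<and> \<theta> > 0 \<longrightarrow> zb = z_star y Z (\<theta> / norm zb))
        \<and> (\<theta> = 0 \<longrightarrow> zb \<in> Z_zero y Z)
        \<and> (zb = 0 \<longrightarrow> zb = z_star_inf Z))
    \<and> (\<forall>\<gamma>>0. z_star y Z \<gamma> \<in> S_ball y Z (theta_of y Z \<gamma>))
    \<and> mono_on {0<..} (theta_of y Z)"
proof (intro conjI allI impI ballI)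
  have Z: "Z \<noteq> {}" "closed Z" "convex Z"
    using assms by (simp_all add: compact_imp_closed)
  show "\<exists>!z. z \<in> argmin_set (reg_objective y \<gamma>) Z" if "\<gamma> > 0" for \<gamma>
    using reg_argmin_iff_closest_point[OF Z that] by simp
  show "(z_star y Z \<longlongrightarrow> z_star_inf Z) at_top"
    by (rule z_star_tendsto_z_star_inf[OF Z])
  show "zb = z_star y Z (\<theta> / norm zb)" if "zb \<in> S_ball y Z \<theta>" "zb \<noteq> 0 \<and> \<theta> > 0" for \<theta> zb
    using S_ball_subset_reg_argmin[of zb y Z \<theta>] that
    by (simp add: reg_argmin_iff_closest_point[OF Z] z_star_eq_closest_point[OF Z])
  show "zb \<in> Z_zero y Z" if "zb \<in> S_ball y Z \<theta>" "\<theta> = 0" for \<theta> zb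
    using that by (simp add: S_ball_def Z_zero_def)
  \<comment> \<open>Here \<open>0\<close> lies in \<open>Z\<close>, so the projection fixes
    it.\<close>
  show "zb = z_star_inf Z" if "zb \<in> S_ball y Z \<theta>" "zb = 0" for \<theta> zb
    using that by (simp add: S_ball_def mem_argmin_set_iff z_star_inf_def closest_point_self)
  show "z_star y Z \<gamma> \<in> S_ball y Z (theta_of y Z \<gamma>)" if "\<gamma> > 0" for \<gamma>
    by (rule z_star_in_S_ball[OF Z that])
  show "mono_on {0<..} (theta_of y Z)"
    by (rule theta_of_mono[OF Z])
qed

end
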